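(* Let $n\in\mathbb{N}$ and let $K_{1,n}$ be the star with center $r$, leaves $v_0,\dots,v_{n-1}$, and edges $i=rv_i$ for $0\leq i<n$. Let $S=\{\{v_i,v_j\}:0\leq i<j<n\}$. Then the inequality $\sum_{e\in E(K_{1,n})}x_e\geq n-1$ defines a shared facet of $\mathrm{MultC}(K_{1,n},S)$.
   Context: Given a graph $G=(V,E)$ and $S\subseteq\binom{V}{2}$, an ($S$-)multicut is a set $\delta\subseteq E$ such that for every $\{s,t\}\in S$ the nodes $s$ and $t$ lie in different components of $G-\delta$. For $F\subseteq E$, $x^F\in\mathbb{R}^E$ is its incidence vector. The multicut polytope is $\mathrm{MultC}^{\square}(G,S)=\mathrm{conv}\{x^\delta:\delta\text{ an } S\text{-multicut}\}$ and the multicut dominant is $\mathrm{MultC}(G,S)=\mathrm{MultC}^{\square}(G,S)+\mathbb{R}^E_{\geq 0}$. A facet-defining inequality of $\mathrm{MultC}(G,S)$ defines a shared facet if it is also facet-defining for $\mathrm{MultC}^{\square}(G,S)$. *)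

theory Defs
  imports "HOL-Analysis.Analysis"
begin

type_synonym 'v ugraph = "'v set \<times> 'v set set"

definition simple_graph :: "'v ugraph \<Rightarrow> bool" where
  "simple_graph G \<longleftrightarrow> finite (fst G) \<and> (\<forall>e \<in> snd G. e \<subseteq> fst G \<and> card e = 2)"

definition delete_edges :: "'v ugraph \<Rightarrow> 'v set set \<Rightarrow> 'v ugraph" where
  "delete_edges G F = (fst G, snd G - F)"

definition component :: "'v ugraph \<Rightarrow> 'v \<Rightarrow> 'v set" where
  "component G u = {w. (u, w) \<in> {(a, b). {a, b} \<in> snd G}\<^sup>*}"

definition multicut :: "'v ugraph \<Rightarrow> 'v set set \<Rightarrow> 'v set set \<Rightarrow> bool" where
  "multicut G S \<delta> \<longleftrightarrow> \<delta> \<subseteq> snd G \<and>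
     (\<forall>s t. {s, t} \<in> S \<longrightarrow> component (delete_edges G \<delta>) s \<noteq> component (delete_edges G \<delta>) t)"

text \<open>The space of real vectors indexed by the edge set \<open>E\<close> is the coordinate subspace of
  \<^typ>\<open>real ^ ('v::finite set)\<close> consisting of the vectors that vanish at every index outside \<open>E\<close>.
  In this way the edge set can vary while convex hulls and affine dimensions remain those of the
  library.\<close>

definition edge_space :: "('v::finite) ugraph \<Rightarrow> (real ^ ('v set)) set" where
  "edge_space G = {x. \<forall>e. e \<notin> snd G \<longrightarrow> x $ e = 0}"

definition incidence_vector :: "('v::finite) set set \<Rightarrow> real ^ ('v set)" where
  "incidence_vector F = (\<chi> e. if e \<in> F then 1 else 0)"

definition multicut_polytope :: "('v::finite) ugraph \<Rightarrow> 'v set set \<Rightarrow> (real ^ ('v set)) set" where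
  "multicut_polytope G S = convex hull {incidence_vector \<delta> | \<delta>. multicut G S \<delta>}"

definition multicut_dominant :: "('v::finite) ugraph \<Rightarrow> 'v set set \<Rightarrow> (real ^ ('v set)) set" where
  "multicut_dominant G S =
     {x + y | x y. x \<in> multicut_polytope G S \<and> y \<in> edge_space G \<and> (\<forall>e \<in> snd G. 0 \<le> y $ e)}"

text \<open>The inequality \<open>f x \<ge> b\<close> is facet-defining for \<open>P\<close> if it is valid for \<open>P\<close> and the face it
  induces has dimension \<open>dim P - 1\<close>. Unlike \<^const>\<open>facet_of\<close>, this admits the empty face
  (of dimension \<open>-1\<close>) as the facet of a single point; for nonempty faces the two notions agree,
  see \<open>facet_defining_iff_facet_of\<close>.\<close>

definition facet_defining ::
    "('a::euclidean_space \<Rightarrow> real) \<Rightarrow> real \<Rightarrow> 'a set \<Rightarrow> bool" where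
  "facet_defining f b P \<longleftrightarrow> linear f \<and> (\<forall>x \<in> P. f x \<ge> b) \<and>
     aff_dim {x \<in> P. f x = b} = aff_dim P - 1"

definition defines_shared_facet ::
    "('v::finite) ugraph \<Rightarrow> 'v set set \<Rightarrow> (real ^ ('v set) \<Rightarrow> real) \<Rightarrow> real \<Rightarrow> bool" where
  "defines_shared_facet G S f b \<longleftrightarrow>
     facet_defining f b (multicut_dominant G S) \<and> facet_defining f b (multicut_polytope G S)"

definition star :: "'v \<Rightarrow> (nat \<Rightarrow> 'v) \<Rightarrow> nat \<Rightarrow> 'v ugraph" where
  "star r v n = (insert r (v ` {..<n}), {{r, v i} | i. i < n})"

definition leaf_pairs :: "(nat \<Rightarrow> 'v) \<Rightarrow> nat \<Rightarrow> 'v set set" where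
  "leaf_pairs v n = {{v i, v j} | i j. i < j \<and> j < n}"

lemma simple_graph_star:
  assumes "r \<notin> v ` {..<n}"
  shows "simple_graph (star r v n)"
  using assms by (auto simp: simple_graph_def star_def card_insert_if)

lemma leaf_pairs_subset:
  assumes "inj_on v {..<n}"
  shows "leaf_pairs v n \<subseteq> {p. p \<subseteq> fst (star r v n) \<and> card p = 2}"
proof
  fix p assume "p \<in> leaf_pairs v n"
  then obtain i j where ij: "p = {v i, v j}" "i < j" "j < n"
    by (auto simp: leaf_pairs_def)
  then have "v i \<noteq> v j"
    using inj_onD[OF assms, of i j] by auto
  with ij show "p \<in> {p. p \<subseteq> fst (star r v n) \<and> card p = 2}"
    by (auto simp: star_def)
qed

lemma facet_defining_iff_facet_of:
  fixes f :: "'a::euclidean_space \<Rightarrow> real"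
  assumes "convex P" "linear f" "{x \<in> P. f x = b} \<noteq> {}"
  shows "facet_defining f b P \<longleftrightarrow> (\<forall>x \<in> P. f x \<ge> b) \<and> {x \<in> P. f x = b} facet_of P"
proof -
  have a: "f = (\<lambda>x. adjoint f 1 \<bullet> x)"
  proof
    fix x
    have "x \<bullet> adjoint f 1 = f x \<bullet> 1"
      by (rule adjoint_works[OF assms(2)])
    then show "f x = adjoint f 1 \<bullet> x"
      by (simp add: inner_commute)
  qed
  have "{x \<in> P. f x = b} face_of P" if "\<forall>x \<in> P. f x \<ge> b"
  proof -
    have "P \<inter> {x. adjoint f 1 \<bullet> x = b} face_of P"
      using assms(1) that by (intro face_of_Int_supporting_hyperplane_ge) (metis a)+
    moreover have "P \<inter> {x. adjoint f 1 \<bullet> x = b} = {x \<in> P. f x = b}"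
      by (subst (2) a) auto
    ultimately show ?thesis
      by simp
  qed
  then show ?thesis
    using assms by (auto simp: facet_defining_def facet_of_def)
qed

end

theory Submission
  imports Defs
begin

text \<open>A set of star edges separates all leaves iff it misses at most one edge, so it has at least
  \<open>n - 1\<close> elements. Hence polytope and dominant both lie in the edge space, satisfy the inequality
  and contain the vectors \<open>x\<^sup>E\<close> and \<open>x\<^sup>E - x\<^sup>{\<^sup>e\<^sup>}\<close> for \<open>e \<in> E\<close>, which affinely span the edge space.
  All of these except \<open>x\<^sup>E\<close> satisfy the inequality with equality, so the face has dimension
  \<open>n - 1\<close> in both cases.\<close>

section \<open>Multicuts of the star\<close>

lemma card_edges_star:
  assumes "inj_on v {..<n}" and "r \<notin> v ` {..<n}"
  shows "card (snd (star r v n)) = n"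
proof -
  have "snd (star r v n) = (\<lambda>i. {r, v i}) ` {..<n}"
    by (auto simp: star_def)
  moreover have "inj_on (\<lambda>i. {r, v i}) {..<n}"
    using assms by (auto simp: inj_on_def doubleton_eq_iff)
  ultimately show ?thesis
    by (simp add: card_image)
qed

lemma component_refl: "u \<in> component G u"
  by (simp add: component_def)

lemma component_isolated:
  assumes "\<And>w. {u, w} \<notin> snd G"
  shows "component G u = {u}"
proof -
  have "w = u" if "(u, w) \<in> {(a, b). {a, b} \<in> snd G}\<^sup>*" for w
    using that by (rule converse_rtranclE) (use assms in auto)
  then show ?thesis
    by (auto simp: component_def)
qed

lemma component_edge_subset:
  assumes "{a, b} \<in> snd G"
  shows "component G b \<subseteq> component G a"
  using assms unfolding component_def by (auto intro: converse_rtrancl_into_rtrancl)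

lemma component_edge:
  assumes "{a, b} \<in> snd G"
  shows "component G a = component G b"
  using component_edge_subset[of a b G] component_edge_subset[of b a G] assms
  by (simp add: insert_commute)

text \<open>Two surviving edges would join their leaves through \<open>r\<close>. Conversely, if at
  most one edge survives, then of any two leaves at least one is isolated, so the two lie in
  different components.\<close>

lemma multicut_star_iff:
  fixes r :: "'v::finite"
  assumes inj: "inj_on v {..<n}" and r: "r \<notin> v ` {..<n}"
  shows "multicut (star r v n) (leaf_pairs v n) \<delta> \<longleftrightarrow>
           \<delta> \<subseteq> snd (star r v n) \<and> card (snd (star r v n) - \<delta>) \<le> 1"
    (is "?M \<longleftrightarrow> _ \<and> card (?E - \<delta>) \<le> 1")
proof (intro iffI conjI)
  let ?H = "delete_edges (star r v n) \<delta>"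
  assume M: ?M
  then show "\<delta> \<subseteq> ?E"
    by (simp add: multicut_def)
  have "e = e'" if ee: "e \<in> ?E - \<delta>" "e' \<in> ?E - \<delta>" for e e'
  proof (rule ccontr)
    assume "e \<noteq> e'"
    with ee obtain i j where ij: "e = {r, v i}" "e' = {r, v j}" "i < n" "j < n" "i \<noteq> j"
      by (auto simp: star_def)
    \<comment> \<open>\<open>leaf_pairs\<close> lists indices in increasing order, while
      \<open>i\<close> and \<open>j\<close> are merely distinct; hence the case split on
      \<open>i < j\<close>.\<close>
    have leaf: "{v k, v l} \<in> leaf_pairs v n" if "k < l" "l < n" for k l
      using that by (auto simp: leaf_pairs_def)
    have "{v i, v j} \<in> leaf_pairs v n"
      using leaf[of i j] leaf[of j i] ij by (cases "i < j") (auto simp: insert_commute)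
    then have "component ?H (v i) \<noteq> component ?H (v j)"
      using M by (simp add: multicut_def)
    moreover have "component ?H r = component ?H (v i)" "component ?H r = component ?H (v j)"
      using ee ij by (auto intro!: component_edge simp: delete_edges_def)
    ultimately show False
      by simp
  qed
  then show "card (?E - \<delta>) \<le> 1"
    by (simp add: card_le_Suc0_iff_eq)
next
  let ?H = "delete_edges (star r v n) \<delta>"
  assume A: "\<delta> \<subseteq> ?E \<and> card (?E - \<delta>) \<le> 1"
  \<comment> \<open>All sets over the finite type \<open>'v\<close> are finite, so the bound on
    \<open>card\<close> is not met by the default value 0 of infinite sets and really says that any
    two surviving edges coincide.\<close>
  then have eq: "e = e'" if "e \<in> ?E - \<delta>" "e' \<in> ?E - \<delta>" for e e'
    using that by (metis One_nat_def card_le_Suc0_iff_eq finite_code)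
  have iso: "component ?H (v i) = {v i}" if i: "i < n" "{r, v i} \<in> \<delta>" for i
  proof (rule component_isolated)
    fix w
    \<comment> \<open>An edge at \<open>v i\<close> is some \<open>{r, v k}\<close>, and
      \<open>v i\<close> is not \<open>r\<close>; so deleting \<open>{r, v i}\<close> removes the
      only edge at this leaf.\<close>
    have "{v i, w} = {r, v i}" if "{v i, w} \<in> ?E"
      using that i r inj by (auto simp: star_def doubleton_eq_iff inj_on_def)
    then show "{v i, w} \<notin> snd ?H"
      using i by (auto simp: delete_edges_def)
  qed
  have sep: "component ?H (v i) \<noteq> component ?H (v j)" if ij: "i < n" "j < n" "i \<noteq> j" for i j
  proof -
    have ne: "v i \<noteq> v j"
      using inj ij by (auto simp: inj_on_def)
    then have "{r, v i} \<noteq> {r, v j}"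
      by (auto simp: doubleton_eq_iff)
    moreover have "{r, v i} \<in> ?E" "{r, v j} \<in> ?E"
      using ij by (auto simp: star_def)
    ultimately have "{r, v i} \<in> \<delta> \<or> {r, v j} \<in> \<delta>"
      using eq by blast
    then have "component ?H (v i) = {v i} \<or> component ?H (v j) = {v j}"
      using iso ij(1,2) by blast
    then show ?thesis
      using ne component_refl[of "v i" ?H] component_refl[of "v j" ?H] by (metis singletonD)
  qed
  have "component ?H s \<noteq> component ?H t" if st: "{s, t} \<in> leaf_pairs v n" for s t
  proof -
    from st obtain i j where ij: "{s, t} = {v i, v j}" "i < j" "j < n"
      by (auto simp: leaf_pairs_def)
    then show ?thesis
      using sep[of i j] sep[of j i] by (auto simp: doubleton_eq_iff)
  qed
  with A show ?M
    by (simp add: multicut_def)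
qed

section \<open>The edge space and affine dimensions\<close>

lemma subspace_edge_space: "subspace (edge_space G)"
  by (auto simp: edge_space_def subspace_def)

lemma incidence_vector_in_edge_space:
  "F \<subseteq> snd G \<Longrightarrow> incidence_vector F \<in> edge_space G"
  by (auto simp: edge_space_def incidence_vector_def)

lemma sum_incidence_vector: "(\<Sum>e\<in>E. incidence_vector F $ e) = real (card (E \<inter> F))"
  by (simp add: incidence_vector_def flip: sum.inter_restrict)

lemma linear_sum_components: "linear (\<lambda>x :: real ^ 'n. \<Sum>e\<in>E. x $ e)"
  by (rule linearI) (simp_all add: sum.distrib sum_distrib_left)

lemma axis_in_edge_space_iff: "axis e (1::real) \<in> edge_space G \<longleftrightarrow> e \<in> snd G"
  by (auto simp: edge_space_def axis_def)

lemma edge_space_eq_span: "edge_space G = span ((\<lambda>e. axis e 1) ` snd G)"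
proof
  show "edge_space G \<subseteq> span ((\<lambda>e. axis e 1) ` snd G)"
  proof
    fix x assume x: "x \<in> edge_space G"
    have "x = (\<Sum>e\<in>snd G. x $ e *\<^sub>R axis e 1)"
      using x by (auto simp: vec_eq_iff edge_space_def axis_def if_distrib cong: if_cong)
    also have "\<dots> \<in> span ((\<lambda>e. axis e 1) ` snd G)"
      by (intro span_sum span_scale span_base imageI)
    finally show "x \<in> span ((\<lambda>e. axis e 1) ` snd G)" .
  qed
  show "span ((\<lambda>e. axis e 1) ` snd G) \<subseteq> edge_space G"
    by (rule span_minimal) (auto simp: axis_in_edge_space_iff subspace_edge_space)
qed

lemma dim_edge_space: "dim (edge_space G) = card (snd G)"
proof -
  let ?B = "(\<lambda>e. axis e (1::real)) ` snd G"
  have "independent ?B"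
    by (rule independent_mono[OF independent_Basis]) (auto simp: Basis_vec_def)
  then have "dim (edge_space G) = card ?B"
    by (simp add: edge_space_eq_span dim_eq_card_independent)
  also have "\<dots> = card (snd G)"
    by (intro card_image) (auto simp: inj_on_def axis_eq_axis)
  finally show ?thesis .
qed

lemma aff_dim_edge_space: "aff_dim (edge_space G) = int (card (snd G))"
  by (simp add: aff_dim_subspace subspace_edge_space dim_edge_space)

lemma incidence_vector_Diff_singleton:
  "e \<in> E \<Longrightarrow> incidence_vector (E - {e}) = incidence_vector E - axis e 1"
  by (auto simp: incidence_vector_def vec_eq_iff axis_def)

text \<open>Translating by the incidence vector of the full edge set turns the points into 0 and the
  negated unit vectors of the edges; as 0 is among them, affine dimension becomes linear
  dimension.\<close>

lemma aff_dim_incidence_vectors: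
  fixes G :: "('v::finite) ugraph"
  shows "aff_dim (insert (incidence_vector (snd G))
           ((\<lambda>e. incidence_vector (snd G - {e})) ` snd G)) = int (card (snd G))"
    (is "aff_dim ?T = _")
proof -
  let ?a = "incidence_vector (snd G)"
  let ?B = "(\<lambda>e. axis e (1::real)) ` snd G"
  have "?T = (\<lambda>x. ?a + x) ` insert 0 (uminus ` ?B)"
    by (auto simp: image_image incidence_vector_Diff_singleton)
  then have "aff_dim ?T = aff_dim (insert 0 (uminus ` ?B))"
    by (simp only: aff_dim_translation_eq)
  also have "\<dots> = int (dim (insert 0 (uminus ` ?B)))"
    by (rule aff_dim_zero) (simp add: hull_inc)
  also have "dim (insert 0 (uminus ` ?B)) = dim (uminus ` ?B)"
    by (metis dim_span span_insert_0)
  also have "\<dots> = dim ?B"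
    by (rule dim_image_eq) (auto intro: linear_uminus)
  also have "\<dots> = card (snd G)"
    by (metis dim_edge_space dim_span edge_space_eq_span)
  finally show ?thesis .
qed

text \<open>Common criterion for polytope and dominant: only a sandwich of \<open>P\<close> between
  the spanning points and the edge space is used, besides validity. Without edges the face is empty
  and has dimension -1, as \<open>facet_defining\<close> demands.\<close>

lemma facet_defining_edge_sum:
  fixes G :: "('v::finite) ugraph"
  defines "f \<equiv> \<lambda>x :: real ^ ('v set). \<Sum>e\<in>snd G. x $ e"
    and "T \<equiv> (\<lambda>e. incidence_vector (snd G - {e})) ` snd G"
  assumes T: "insert (incidence_vector (snd G)) T \<subseteq> P" and P: "P \<subseteq> edge_space G"
    and valid: "\<And>x. x \<in> P \<Longrightarrow> f x \<ge> real (card (snd G)) - 1"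
  shows "facet_defining f (real (card (snd G)) - 1) P"
proof -
  let ?a = "incidence_vector (snd G)" and ?b = "real (card (snd G)) - 1"
  let ?F = "{x \<in> P. f x = ?b}"
  \<comment> \<open>Both ends of the sandwich have affine dimension \<open>card (snd G)\<close>.
    This serves twice: for \<open>P\<close> itself and for the face enlarged by
    \<open>?a\<close>.\<close>
  have span: "aff_dim Q = int (card (snd G))" if "insert ?a T \<subseteq> Q" "Q \<subseteq> edge_space G" for Q
    using aff_dim_subset[OF that(1)] aff_dim_subset[OF that(2)]
    by (simp add: T_def aff_dim_incidence_vectors aff_dim_edge_space)
  have lin: "linear f"
    unfolding f_def by (rule linear_sum_components)
  have "f x = ?b" if x: "x \<in> T" for x
  proof -
    obtain e where e: "e \<in> snd G" "x = incidence_vector (snd G - {e})"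
      using x by (auto simp: T_def)
    then have "f x = real (card (snd G - {e}))"
      by (simp add: f_def sum_incidence_vector Int_absorb1)
    also have "\<dots> = real (card (snd G) - 1)"
      using e by simp
    \<comment> \<open>The edge \<open>e\<close> makes the cardinality positive, so the truncated
      subtraction on \<open>nat\<close> agrees with the real one.\<close>
    also have "\<dots> = ?b"
      using e by (metis card_gt_0_iff empty_iff finite_code of_nat_1 of_nat_diff Suc_leI One_nat_def)
    finally show ?thesis .
  qed
  then have "aff_dim (insert ?a ?F) = int (card (snd G))"
    using T P by (intro span) auto
  \<comment> \<open>The affine hull stays in the hyperplane where \<open>f\<close> equals
    \<open>?b\<close>, but \<open>f ?a\<close> is \<open>?b + 1\<close>. Hence adding
    \<open>?a\<close> to the face raises its dimension by exactly one.\<close>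
  moreover have "?a \<notin> affine hull ?F"
  proof
    assume "?a \<in> affine hull ?F"
    moreover have "affine hull ?F \<subseteq> {x. f x = ?b}"
      by (rule hull_minimal)
        (auto simp: affine_def linear_add[OF lin] linear_scale[OF lin] simp flip: distrib_right)
    ultimately show False
      by (auto simp: f_def sum_incidence_vector)
  qed
  ultimately have "aff_dim ?F = int (card (snd G)) - 1"
    by (simp add: aff_dim_insert)
  then show ?thesis
    using span[OF T P] valid lin by (simp add: facet_defining_def)
qed

section \<open>Polytope and dominant of the star\<close>

lemma multicut_polytope_subset_edge_space: "multicut_polytope G S \<subseteq> edge_space G"
  unfolding multicut_polytope_def
  by (rule hull_minimal)
    (auto simp: multicut_def subspace_edge_space subspace_imp_convex
      intro!: incidence_vector_in_edge_space)

lemma multicut_polytope_subset_dominant: "multicut_polytope G S \<subseteq> multicut_dominant G S"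
proof
  fix x assume "x \<in> multicut_polytope G S"
  moreover have "x = x + 0" "0 \<in> edge_space G"
    by (auto simp: edge_space_def)
  ultimately show "x \<in> multicut_dominant G S"
    unfolding multicut_dominant_def by fastforce
qed

lemma multicut_dominant_subset_edge_space: "multicut_dominant G S \<subseteq> edge_space G"
  using multicut_polytope_subset_edge_space[of G S] subspace_edge_space[of G]
  by (auto simp: multicut_dominant_def intro: subspace_add)

theorem theorem5p3:
  fixes n :: nat and r :: "'v::finite" and v :: "nat \<Rightarrow> 'v"
  assumes "inj_on v {..<n}" and "r \<notin> v ` {..<n}"
  shows "defines_shared_facet (star r v n) (leaf_pairs v n)
           (\<lambda>x. \<Sum>e \<in> snd (star r v n). x $ e) (real n - 1)"
proof -
  let ?G = "star r v n" and ?S = "leaf_pairs v n"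
  let ?E = "snd ?G"
  let ?f = "\<lambda>x :: real ^ ('v set). \<Sum>e\<in>?E. x $ e"
  have n: "card ?E = n"
    using assms by (rule card_edges_star)
  have mc: "incidence_vector \<delta> \<in> multicut_polytope ?G ?S"
    if "\<delta> \<subseteq> ?E" "card (?E - \<delta>) \<le> 1" for \<delta>
    unfolding multicut_polytope_def by (rule hull_inc) (use multicut_star_iff[OF assms] that in auto)
  \<comment> \<open>The sets \<open>?E\<close> and \<open>?E - {e}\<close> miss no edge and only
    \<open>e\<close>, respectively, so they are multicuts.\<close>
  have T: "insert (incidence_vector ?E) ((\<lambda>e. incidence_vector (?E - {e})) ` ?E)
      \<subseteq> multicut_polytope ?G ?S"
    by (auto intro!: mc simp: double_diff)
  have "?f (incidence_vector \<delta>) \<ge> real n - 1" if "multicut ?G ?S \<delta>" for \<delta>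
  proof -
    have "\<delta> \<subseteq> ?E" "card (?E - \<delta>) \<le> 1"
      using that multicut_star_iff[OF assms] by auto
    moreover from this have "card ?E = card \<delta> + card (?E - \<delta>)"
      by (metis card_Diff_subset card_mono finite_code le_add_diff_inverse)
    ultimately show ?thesis
      by (simp add: sum_incidence_vector Int_absorb1 n)
  qed
  \<comment> \<open>Convexity of the half-space carries validity from the incidence vectors of
    multicuts to their convex hull.\<close>
  moreover have "convex {x. ?f x \<ge> real n - 1}"
  proof -
    have "{x. ?f x \<ge> real n - 1} = ?f -` {real n - 1..}"
      by auto
    then show ?thesis
      by (simp only: convex_linear_vimage[OF linear_sum_components] convex_real_interval)
  qed
  ultimately have "multicut_polytope ?G ?S \<subseteq> {x. ?f x \<ge> real n - 1}"
    unfolding multicut_polytope_def by (intro hull_minimal) auto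
  then have poly: "?f x \<ge> real n - 1" if "x \<in> multicut_polytope ?G ?S" for x
    using that by auto
  \<comment> \<open>All coefficients of \<open>?f\<close> are nonnegative, so the nonnegative
    summand of a point of the dominant cannot lower its value.\<close>
  have dom: "?f x \<ge> real n - 1" if "x \<in> multicut_dominant ?G ?S" for x
  proof -
    obtain y z where "x = y + z" "y \<in> multicut_polytope ?G ?S" "\<forall>e\<in>?E. 0 \<le> z $ e"
      using \<open>x \<in> multicut_dominant ?G ?S\<close> by (auto simp: multicut_dominant_def)
    then show ?thesis
      using poly[of y] sum_nonneg[of ?E "\<lambda>e. z $ e"] by (simp add: sum.distrib)
  qed
  have "facet_defining ?f (real n - 1) (multicut_polytope ?G ?S)"
    using facet_defining_edge_sum[OF T multicut_polytope_subset_edge_space] poly by (simp add: n)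
  moreover have "facet_defining ?f (real n - 1) (multicut_dominant ?G ?S)"
    using facet_defining_edge_sum[OF subset_trans[OF T multicut_polytope_subset_dominant]
        multicut_dominant_subset_edge_space] dom by (simp add: n)
  ultimately show ?thesis
    by (simp add: defines_shared_facet_def)
qed

end
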